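(* Let $A \in S(2n,\mathbb{R})$ and $0\le k\le n-1$. For a subset $S\subseteq\{1,\dots,n\}$ with $|S| = k$, let $A_S$ be the $(2n-2k)\times(2n-2k)$ submatrix of $A$ obtained by deleting rows and columns $2i-1$ and $2i$ for all $i\in S$, and set $s_k(A) = \sum_{S\subseteq\{1,\dots,n\},\,|S|=k}\operatorname{Pf}(A_S)$. Then for every $P \in \operatorname{Sp}(2n)$, $s_k(P^T A P) = s_k(A)$.
   Context: $S(2n,\mathbb{R}) = \{A \in M(2n,\mathbb{R}) : A^T = -A,\ \det A\neq 0\}$. $J$ is the $2n\times 2n$ block-diagonal matrix with $n$ diagonal blocks $J_0 = \begin{bmatrix} 0 & 1 \\ -1 & 0\end{bmatrix}$, and $\operatorname{Sp}(2n) = \{P\in M(2n,\mathbb{R}) : P^T J P = J\}$. For a skew-symmetric $2m\times 2m$ matrix $B$, $\operatorname{Pf}(B) = \frac{1}{2^m m!}\sum_{\sigma\in S_{2m}}\operatorname{sgn}(\sigma)\prod_{i=1}^m B_{\sigma(2i-1),\sigma(2i)}$. *)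

theory Defs
  imports "Jordan_Normal_Form.Determinant" "Jordan_Normal_Form.DL_Submatrix"
    "HOL-Combinatorics.Permutations"
begin

text \<open>Indices are 0-based: the i-th 2x2 block (i < n) occupies rows/columns 2i and 2i+1.\<close>

definition skew_inv :: "nat \<Rightarrow> real mat set" where
  "skew_inv n = {A. A \<in> carrier_mat (2*n) (2*n) \<and> transpose_mat A = - A \<and> det A \<noteq> 0}"

definition Jmat :: "nat \<Rightarrow> real mat" where
  "Jmat n = mat (2*n) (2*n) (\<lambda>(i,j). if even i \<and> j = i + 1 then 1
                                     else if odd i \<and> i = j + 1 then -1 else 0)"

definition Sp :: "nat \<Rightarrow> real mat set" where
  "Sp n = {P. P \<in> carrier_mat (2*n) (2*n) \<and> transpose_mat P * Jmat n * P = Jmat n}"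

definition pfaffian :: "real mat \<Rightarrow> real" where
  "pfaffian B = (let m = dim_row B div 2 in
     (1 / (2 ^ m * fact m)) *
     (\<Sum>\<sigma> | \<sigma> permutes {0..<2*m}.
        of_int (sign \<sigma>) * (\<Prod>i<m. B $$ (\<sigma> (2*i), \<sigma> (2*i+1)))))"

definition delete_blocks :: "real mat \<Rightarrow> nat set \<Rightarrow> real mat" where
  "delete_blocks A S = submatrix A {j. j div 2 \<notin> S} {j. j div 2 \<notin> S}"

definition s_k :: "nat \<Rightarrow> nat \<Rightarrow> real mat \<Rightarrow> real" where
  "s_k n k A = (\<Sum>S | S \<subseteq> {0..<n} \<and> card S = k. pfaffian (delete_blocks A S))"

end

theory Submission
  imports Defs
begin

text \<open>
  The unnormalised Pfaffian polarises to a form in n matrices, the mixed Pfaffian, which gains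
  the factor \<open>det P\<close> under simultaneous congruence of its arguments by \<open>P\<close>. With J in k of the
  n slots and A in the others, a permutation contributes only if it maps the pairs in the J-slots
  onto 2x2 blocks; sorting by the set S of these blocks, and moving S to the end by an even
  permutation of blocks, gives a nonzero multiple of \<open>s_k n k A\<close>. A symplectic congruence
  fixes J, and \<open>det P = 1\<close> because the mixed Pfaffian of n copies of J is nonzero.
\<close>

section \<open>Mixed Pfaffians and their behaviour under congruence\<close>

text \<open>The slots hold functions of two indices instead of matrices, so that passing to a
  submatrix is composition with an index map.\<close>

definition mixed_pf :: "nat \<Rightarrow> (nat \<Rightarrow> nat \<Rightarrow> nat \<Rightarrow> real) \<Rightarrow> real" where
  "mixed_pf n B = (\<Sum>\<sigma> | \<sigma> permutes {0..<2*n}.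
     of_int (sign \<sigma>) * (\<Prod>i<n. B i (\<sigma> (2*i)) (\<sigma> (2*i+1))))"

text \<open>The entries of \<open>Jmat\<close> as a total function without a size, so that the same
  function can fill slots of forms of every size.\<close>

definition Jfun :: "nat \<Rightarrow> nat \<Rightarrow> real" where
  "Jfun i j = (if even i \<and> j = i + 1 then 1 else if odd i \<and> i = j + 1 then -1 else 0)"

text \<open>The action of a map of block indices on the row indices.\<close>

definition dbl :: "(nat \<Rightarrow> nat) \<Rightarrow> nat \<Rightarrow> nat" where
  "dbl e x = 2 * e (x div 2) + x mod 2"

lemma mixed_pf_cong:
  assumes "\<And>i a b. \<lbrakk>i < n; a < 2*n; b < 2*n\<rbrakk> \<Longrightarrow> B i a b = C i a b"
  shows "mixed_pf n B = mixed_pf n C"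
  unfolding mixed_pf_def
proof (rule sum.cong, simp, rule arg_cong2[where f = "(*)"], simp, rule prod.cong, simp)
  fix \<sigma> i assume "\<sigma> \<in> {\<sigma>. \<sigma> permutes {0..<2*n}}" "i \<in> {..<n}"
  then show "B i (\<sigma> (2*i)) (\<sigma> (2*i+1)) = C i (\<sigma> (2*i)) (\<sigma> (2*i+1))"
    using permutes_in_image[of \<sigma> "{0..<2*n}" "2*i"] permutes_in_image[of \<sigma> "{0..<2*n}" "2*i+1"]
    by (intro assms) auto
qed

lemma prod_pairs: "(\<Prod>j<2*n. g j) = (\<Prod>i<n. g (2*i) * g (2*i+1))" for g :: "nat \<Rightarrow> real"
  by (induction n) (auto simp: mult_ac)

lemma det_repeated_rows:
  assumes P: "P \<in> carrier_mat N N" and f: "\<And>j. j < N \<Longrightarrow> f j < N" and ninj: "\<not> inj_on f {0..<N}"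
  shows "det (mat N N (\<lambda>(j,c). P $$ (f j, c))) = (0 :: real)"
proof -
  obtain i j where ij: "i < N" "j < N" "i \<noteq> j" "f i = f j" using ninj by (auto simp: inj_on_def)
  show ?thesis
    by (rule det_identical_rows[of _ N i j]) (use ij in \<open>auto intro!: eq_vecI\<close>)
qed

text \<open>A Cauchy-Binet argument. Expanding the product of double sums chooses an index pair in
  every slot, that is, a row of \<open>P\<close> for each position. For a fixed choice, the sum over
  permutations is the Leibniz formula for the matrix of chosen rows. It vanishes if a row repeats
  and is a sign times \<open>det P\<close> otherwise.\<close>

lemma mixed_pf_congruence:
  assumes P: "P \<in> carrier_mat (2*n) (2*n)"
  shows "mixed_pf n (\<lambda>i a b. \<Sum>x<2*n. \<Sum>y<2*n. P $$ (x,a) * B i x y * P $$ (y,b))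
    = det P * mixed_pf n B"
proof -
  let ?X = "{..<2*n}"
  let ?perms = "{\<sigma>. \<sigma> permutes {0..<2*n}}"
  define F where "F = PiE {..<n} (\<lambda>_. ?X \<times> ?X)"
  \<comment> \<open>Flattens the chosen pairs into a sequence of row indices; being the identity
    outside the range allows \<open>row g\<close> to be a permutation of
    \<open>{0..<2*n}\<close>.\<close>
  define row where "row = (\<lambda>(g::nat \<Rightarrow> nat \<times> nat) j. if j < 2*n then (if even j then fst (g (j div 2)) else snd (g (j div 2))) else j)"
  define W where "W = (\<lambda>g::nat \<Rightarrow> nat \<times> nat. \<Prod>i<n. B i (fst (g i)) (snd (g i)))"
  define D where "D = (\<lambda>g. det (mat (2*n) (2*n) (\<lambda>(j,c). P $$ (row g j, c))))"
  have finF: "finite F" unfolding F_def by (intro finite_PiE) auto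
  have row_lt: "row g j < 2*n" if "g \<in> F" "j < 2*n" for g j
  proof -
    have "j div 2 \<in> {..<n}" using that by auto
    with that(1) have "g (j div 2) \<in> ?X \<times> ?X" unfolding F_def by (rule PiE_mem)
    then show ?thesis using that by (auto simp: row_def mem_Times_iff)
  qed
  have expand: "(\<Prod>i<n. \<Sum>x<2*n. \<Sum>y<2*n. P $$ (x,\<sigma> (2*i)) * B i x y * P $$ (y,\<sigma> (2*i+1)))
     = (\<Sum>g\<in>F. W g * (\<Prod>j<2*n. P $$ (row g j, \<sigma> j)))" for \<sigma>
  proof -
    have "(\<Prod>i<n. \<Sum>x<2*n. \<Sum>y<2*n. P $$ (x,\<sigma> (2*i)) * B i x y * P $$ (y,\<sigma> (2*i+1)))
      = (\<Prod>i<n. \<Sum>z\<in>?X \<times> ?X. P $$ (fst z,\<sigma> (2*i)) * B i (fst z) (snd z) * P $$ (snd z,\<sigma> (2*i+1)))"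
      by (simp add: sum.cartesian_product case_prod_beta)
    also have "\<dots> = (\<Sum>g\<in>F. \<Prod>i<n. P $$ (fst (g i),\<sigma> (2*i)) * B i (fst (g i)) (snd (g i)) * P $$ (snd (g i),\<sigma> (2*i+1)))"
      unfolding F_def by (rule prod_sum_PiE) auto
    also have "\<dots> = (\<Sum>g\<in>F. W g * (\<Prod>j<2*n. P $$ (row g j, \<sigma> j)))"
      unfolding prod_pairs W_def prod.distrib[symmetric]
      by (intro sum.cong prod.cong) (auto simp: row_def)
    finally show ?thesis .
  qed
  have "mixed_pf n (\<lambda>i a b. \<Sum>x<2*n. \<Sum>y<2*n. P $$ (x,a) * B i x y * P $$ (y,b))
    = (\<Sum>\<sigma>\<in>?perms. \<Sum>g\<in>F. W g * (of_int (sign \<sigma>) * (\<Prod>j<2*n. P $$ (row g j, \<sigma> j))))"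
    unfolding mixed_pf_def expand by (simp add: sum_distrib_left mult_ac)
  also have "\<dots> = (\<Sum>g\<in>F. W g * (\<Sum>\<sigma>\<in>?perms. of_int (sign \<sigma>) * (\<Prod>j<2*n. P $$ (row g j, \<sigma> j))))"
    by (subst sum.swap) (simp add: sum_distrib_left)
  also have "\<dots> = (\<Sum>g\<in>F. W g * D g)"
  proof (rule sum.cong, simp, rule arg_cong2[where f = "(*)"], simp)
    fix g assume "g \<in> F"
    show "(\<Sum>\<sigma>\<in>?perms. of_int (sign \<sigma>) * (\<Prod>j<2*n. P $$ (row g j, \<sigma> j))) = D g"
      unfolding D_def
      by (subst det_def', rule mat_carrier)
        (auto intro!: sum.cong prod.cong simp: lessThan_atLeast0 permutes_nat_less)
  qed
  also have "\<dots> = (\<Sum>g\<in>{g\<in>F. row g permutes {0..<2*n}}. W g * D g)"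
  proof (rule sum.mono_neutral_right[OF finF], blast, rule ballI)
    fix g assume g: "g \<in> F - {g\<in>F. row g permutes {0..<2*n}}"
    have "\<not> inj_on (row g) {0..<2*n}"
    proof
      assume i: "inj_on (row g) {0..<2*n}"
      have "row g ` {0..<2*n} \<subseteq> {0..<2*n}" using row_lt g by auto
      then have "bij_betw (row g) {0..<2*n} {0..<2*n}"
        using i by (simp add: bij_betw_def endo_inj_surj)
      then have "row g permutes {0..<2*n}"
        by (rule bij_imp_permutes) (auto simp: row_def)
      with g show False by auto
    qed
    then have "D g = 0" unfolding D_def by (intro det_repeated_rows[OF P]) (use row_lt g in auto)
    then show "W g * D g = 0" by simp
  qed
  \<comment> \<open>The surviving choices correspond to the permutations: \<open>row\<close> is
    inverted by reading off consecutive pairs of values, cut down by \<open>restrict\<close> because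
    members of \<open>F\<close> are extensional.\<close>
  also have "\<dots> = (\<Sum>\<sigma>\<in>?perms. det P * (of_int (sign \<sigma>) * (\<Prod>i<n. B i (\<sigma> (2*i)) (\<sigma> (2*i+1)))))"
  proof (rule sum.reindex_bij_witness[where j = row and
        i = "\<lambda>\<sigma>. restrict (\<lambda>i. (\<sigma> (2*i), \<sigma> (2*i+1))) {..<n}"])
    fix g assume g: "g \<in> {g\<in>F. row g permutes {0..<2*n}}"
    show "restrict (\<lambda>i. (row g (2*i), row g (2*i+1))) {..<n} = g"
      using g unfolding F_def by (intro ext) (auto simp: row_def restrict_def PiE_def extensional_def)
    show "row g \<in> ?perms" using g by simp
    have "D g = of_int (sign (row g)) * det P" unfolding D_def
      using g by (intro det_permute_rows[OF P]) auto
    moreover have "W g = (\<Prod>i<n. B i (row g (2*i)) (row g (2*i+1)))"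
      unfolding W_def by (intro prod.cong) (auto simp: row_def)
    ultimately show "det P * (of_int (sign (row g)) * (\<Prod>i<n. B i (row g (2*i)) (row g (2*i+1)))) = W g * D g"
      by simp
  next
    fix \<sigma> assume s: "\<sigma> \<in> ?perms"
    show eq: "row (restrict (\<lambda>i. (\<sigma> (2*i), \<sigma> (2*i+1))) {..<n}) = \<sigma>"
    proof
      fix j
      show "row (restrict (\<lambda>i. (\<sigma> (2*i), \<sigma> (2*i+1))) {..<n}) j = \<sigma> j"
      proof (cases "j < 2*n")
        case True
        then have "j div 2 < n" by auto
        then show ?thesis using True by (auto simp: row_def elim!: oddE)
      next
        case False
        then show ?thesis using s by (auto simp: row_def permutes_not_in)
      qed
    qed
    have "\<sigma> (2*i) < 2*n" "\<sigma> (2*i+1) < 2*n" if "i < n" for i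
      using s that permutes_in_image[of \<sigma> "{0..<2*n}" "2*i"] permutes_in_image[of \<sigma> "{0..<2*n}" "2*i+1"] by auto
    then have "restrict (\<lambda>i. (\<sigma> (2*i), \<sigma> (2*i+1))) {..<n} \<in> F" unfolding F_def by auto
    then show "restrict (\<lambda>i. (\<sigma> (2*i), \<sigma> (2*i+1))) {..<n} \<in> {g\<in>F. row g permutes {0..<2*n}}"
      using s eq by simp
  qed
  finally show ?thesis by (simp add: mixed_pf_def sum_distrib_left)
qed

section \<open>Permutations of blocks and of indices\<close>

lemma dbl_comp: "dbl (f \<circ> g) = dbl f \<circ> dbl g"
  by (auto simp: dbl_def fun_eq_iff)

lemma dbl_transpose:
  "dbl (transpose a b) = transpose (2*a) (2*b) \<circ> transpose (2*a+1) (2*b+1)"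
proof
  fix x :: nat
  have "2*p \<noteq> Suc (2*q)" for p q :: nat by presburger
  note neq = this this[symmetric]
  show "dbl (transpose a b) x = (transpose (2*a) (2*b) \<circ> transpose (2*a+1) (2*b+1)) x"
    by (cases "even x") (auto simp: dbl_def transpose_def neq elim!: evenE oddE)
qed

text \<open>Swapping two blocks swaps two pairs of indices, which is even; induction over
  transpositions extends this to all block permutations.\<close>

lemma dbl_permutes_sign:
  assumes "p permutes {0..<n}"
  shows "dbl p permutes {0..<2*n} \<and> sign (dbl p) = 1"
  using assms finite_atLeastLessThan
proof (induction p rule: permutes_induct)
  case id
  have "dbl id = id" by (auto simp: dbl_def)
  then show ?case by (metis permutes_id sign_id)
next
  case (swap a b p)
  let ?t = "transpose (2*a) (2*b) \<circ> transpose (2*a+1) (2*b+1)"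
  have t: "?t permutes {0..<2*n}" using swap by (intro permutes_compose permutes_swap_id) auto
  have st: "sign ?t = 1" using swap
    by (subst sign_compose) (auto simp: permutation_swap_id sign_swap_id)
  have eq: "dbl (transpose a b \<circ> p) = ?t \<circ> dbl p" by (simp only: dbl_comp dbl_transpose)
  have "permutation ?t" "permutation (dbl p)"
    using t swap permutes_imp_permutation finite_atLeastLessThan by blast+
  then have "sign (?t \<circ> dbl p) = 1" using st swap.IH by (simp add: sign_compose del: comp_apply)
  moreover have "?t \<circ> dbl p permutes {0..<2*n}" using t swap.IH by (blast intro: permutes_compose)
  ultimately show ?case unfolding eq by blast
qed

text \<open>By injectivity a permutation that preserves \<open>Y\<close> also preserves
  \<open>X\<close>, so it is uniquely a product of its restrictions to the two parts. This later
  separates the J-slots from the others.\<close>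

lemma sum_permutes_Un:
  fixes f :: "('a \<Rightarrow> 'a) \<Rightarrow> 'b :: comm_monoid_add"
  assumes "finite X" "finite Y" and disj: "X \<inter> Y = {}"
  shows "(\<Sum>\<sigma> | \<sigma> permutes X \<union> Y \<and> \<sigma> ` Y = Y. f \<sigma>)
    = (\<Sum>p | p permutes X. \<Sum>q | q permutes Y. f (p \<circ> q))"
proof -
  have "(\<Sum>p | p permutes X. \<Sum>q | q permutes Y. f (p \<circ> q))
     = (\<Sum>(p,q)\<in>{p. p permutes X} \<times> {q. q permutes Y}. f (p \<circ> q))"
    by (rule sum.cartesian_product)
  also have "\<dots> = (\<Sum>\<sigma> | \<sigma> permutes X \<union> Y \<and> \<sigma> ` Y = Y. f \<sigma>)"
  proof (rule sum.reindex_bij_witness[where j = "\<lambda>(p,q). p \<circ> q" and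
        i = "\<lambda>\<sigma>. (restrict_id \<sigma> X, restrict_id \<sigma> Y)"])
    fix pq assume "pq \<in> {p. p permutes X} \<times> {q. q permutes Y}"
    then obtain p q where pq: "pq = (p,q)" "p permutes X" "q permutes Y" by auto
    have px: "p x = x" if "x \<notin> X" for x using pq(2) that by (rule permutes_not_in)
    have qx: "q x = x" if "x \<notin> Y" for x using pq(3) that by (rule permutes_not_in)
    have qY: "q x \<notin> X" if "x \<in> Y" for x using permutes_in_image[OF pq(3), of x] that disj by auto
    have nX: "x \<notin> Y" if "x \<in> X" for x using that disj by auto
    show "(restrict_id (case pq of (p, q) \<Rightarrow> p \<circ> q) X, restrict_id (case pq of (p, q) \<Rightarrow> p \<circ> q) Y) = pq"
      using px qx qY nX by (auto simp: pq restrict_id_def fun_eq_iff)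
    have "p permutes X \<union> Y" "q permutes X \<union> Y" using pq by (auto intro: permutes_subset)
    moreover have "(p \<circ> q) ` Y = Y"
    proof -
      have "(p \<circ> q) ` Y = q ` Y" using px qY by (auto simp: image_def)
      then show ?thesis using permutes_image[OF pq(3)] by simp
    qed
    ultimately show "(case pq of (p, q) \<Rightarrow> p \<circ> q) \<in> {\<sigma>. \<sigma> permutes X \<union> Y \<and> \<sigma> ` Y = Y}"
      by (simp add: pq permutes_compose)
    show "f (case pq of (p, q) \<Rightarrow> p \<circ> q) = (case pq of (p, q) \<Rightarrow> f (p \<circ> q))" by (simp add: pq)
  next
    fix \<sigma> assume s: "\<sigma> \<in> {\<sigma>. \<sigma> permutes X \<union> Y \<and> \<sigma> ` Y = Y}"
    have inj: "inj \<sigma>" using s permutes_inj by auto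
    have "\<sigma> ` (X \<union> Y) = X \<union> Y" using s permutes_image by auto
    moreover have "\<sigma> ` X \<inter> \<sigma> ` Y = {}" using disj inj by (auto simp: inj_def)
    ultimately have sX: "\<sigma> ` X = X" using s disj by (auto simp: image_Un)
    have bX: "bij_betw \<sigma> X X" and bY: "bij_betw \<sigma> Y Y"
      using s sX inj by (auto simp: bij_betw_def intro: inj_on_subset)
    then show "(restrict_id \<sigma> X, restrict_id \<sigma> Y) \<in> {p. p permutes X} \<times> {q. q permutes Y}"
      by (auto intro: permutes_restrict_id)
    have "\<sigma> x = x" if "x \<notin> X" "x \<notin> Y" for x using s that by (auto intro: permutes_not_in)
    moreover have "\<sigma> x \<in> Y" if "x \<in> Y" for x using s that by auto
    ultimately show "(case (restrict_id \<sigma> X, restrict_id \<sigma> Y) of (p, q) \<Rightarrow> p \<circ> q) = \<sigma>"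
      using disj by (auto simp: restrict_id_def fun_eq_iff)
  qed
  finally show ?thesis by simp
qed

section \<open>The block structure of J\<close>

lemma Jfun_div_mod: "Jfun a b = (if a div 2 = b div 2 then Jfun (a mod 2) (b mod 2) else 0)"
proof -
  obtain x r where a: "a = 2*x + r" "r = 0 \<or> r = 1" by (metis mult_div_mod_eq not_mod_2_eq_1_eq_0)
  obtain y t where b: "b = 2*y + t" "t = 0 \<or> t = 1" by (metis mult_div_mod_eq not_mod_2_eq_1_eq_0)
  have "Suc (2*x) = Suc (Suc (2*y)) \<longleftrightarrow> False" "Suc (2*x) = 2*y \<longleftrightarrow> False" for x y :: nat by presburger+
  then show ?thesis using a b by (elim disjE) (auto simp: Jfun_def)
qed

text \<open>All diagonal blocks of J are equal, so its entries depend only on whether the two blocks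
  coincide and on the parities of the indices; an injective relabelling of blocks keeps
  both.\<close>

lemma Jfun_dbl:
  assumes "inj_on e U" "a div 2 \<in> U" "b div 2 \<in> U"
  shows "Jfun (dbl e a) (dbl e b) = Jfun a b"
proof -
  have "dbl e x div 2 = e (x div 2)" "dbl e x mod 2 = x mod 2" for x by (auto simp: dbl_def)
  then show ?thesis
    using inj_on_eq_iff[OF assms] by (subst (1 2) Jfun_div_mod) simp
qed

lemma Jfun_nonzero: "Jfun a b \<noteq> 0 \<Longrightarrow> a div 2 = b div 2 \<and> a \<noteq> b"
  by (subst (asm) Jfun_div_mod) (auto simp: Jfun_def split: if_splits)

section \<open>Expansion over the sets of blocks filled by the J-slots\<close>

text \<open>Moves the blocks of \<open>S\<close> to the end. The others keep their increasing order,
  which is how \<open>submatrix\<close> numbers the remaining rows; the order inside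
  \<open>S\<close> is arbitrary.\<close>

lemma block_sort_permutation:
  assumes S: "S \<subseteq> {0..<m+k}" "card S = k"
  obtains p where "p permutes {0..<m+k}" "\<And>i. i < m \<Longrightarrow> p i = pick (- S) i" "p ` {m..<m+k} = S"
proof -
  have fin: "finite S" using S finite_subset by blast
  \<comment> \<open>The complement is taken in all naturals, so \<open>pick (- S)\<close> is defined
    and injective everywhere; its first \<open>m\<close> values are the elements of
    \<open>- S\<close> below \<open>m+k\<close>.\<close>
  have inf: "infinite (- S)" using fin by simp
  have cardC: "card {a. a < m+k \<and> a \<in> - S} = m"
  proof -
    have "{a. a < m+k \<and> a \<in> - S} = {0..<m+k} - S" by auto
    then show ?thesis using S fin by (simp add: card_Diff_subset)
  qed
  have "pick (- S) ` {0..<m} \<subseteq> {0..<m+k} - S"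
    using pick_le[of _ "m+k" "- S"] pick_in_set_inf[OF inf] cardC by auto
  moreover have inj: "inj_on (pick (- S)) {0..<m}"
    using pick_eq_iff_inf[OF inf] by (auto simp: inj_on_def)
  moreover have "card ({0..<m+k} - S) = m" using S fin by (simp add: card_Diff_subset)
  ultimately have "pick (- S) ` {0..<m} = {0..<m+k} - S"
    by (intro card_subset_eq) (auto simp: card_image)
  with inj have b1: "bij_betw (pick (- S)) {0..<m} ({0..<m+k} - S)" by (simp add: bij_betw_def)
  obtain h where b2: "bij_betw h {m..<m+k} S"
    using finite_same_card_bij[of "{m..<m+k}" S] fin S by auto
  define p where "p i = (if i \<in> {0..<m} then pick (- S) i else if i \<in> {m..<m+k} then h i else i)" for i
  have c1: "bij_betw p {0..<m} ({0..<m+k} - S)"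
    using b1 by (rule iffD1[OF bij_betw_cong, rotated]) (simp add: p_def)
  have c2: "bij_betw p {m..<m+k} S"
    using b2 by (rule iffD1[OF bij_betw_cong, rotated]) (simp add: p_def)
  have "bij_betw p ({0..<m} \<union> {m..<m+k}) (({0..<m+k} - S) \<union> S)"
    by (rule bij_betw_combine[OF c1 c2]) auto
  moreover have "{0..<m} \<union> {m..<m+k} = {0..<m+k}" "({0..<m+k} - S) \<union> S = {0..<m+k}" using S by auto
  ultimately have "bij_betw p {0..<m+k} {0..<m+k}" by simp
  then have "p permutes {0..<m+k}" by (rule bij_imp_permutes) (auto simp: p_def)
  moreover have "p ` {m..<m+k} = S" using c2 by (simp add: bij_betw_def)
  moreover have "p i = pick (- S) i" if "i < m" for i using that by (simp add: p_def)
  ultimately show thesis using that by blast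
qed

text \<open>The contribution of the J-slots. Only its independence of A and its nonvanishing matter.\<close>

definition J_const :: "nat \<Rightarrow> nat \<Rightarrow> real" where
  "J_const m k = (\<Sum>q | q permutes {2*m..<2*(m+k)}.
     of_int (sign q) * (\<Prod>i\<in>{m..<m+k}. Jfun (q (2*i)) (q (2*i+1))))"

lemma image_dbl:
  assumes "p ` {m..<m+k} = S"
  shows "dbl p ` {2*m..<2*(m+k)} = {x. x div 2 \<in> S}"
proof (intro equalityI subsetI)
  fix x assume "x \<in> dbl p ` {2*m..<2*(m+k)}"
  then obtain y where "x = dbl p y" "y \<in> {2*m..<2*(m+k)}" by blast
  moreover from this have "y div 2 \<in> {m..<m+k}" by auto
  ultimately show "x \<in> {x. x div 2 \<in> S}" using assms by (auto simp: dbl_def)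
next
  fix x assume "x \<in> {x. x div 2 \<in> S}"
  then obtain i where i: "i \<in> {m..<m+k}" "x div 2 = p i" using assms by auto
  have "dbl p (2*i + x mod 2) = x" using i(2)[symmetric] by (simp add: dbl_def)
  moreover have "2*i + x mod 2 \<in> {2*m..<2*(m+k)}" using i(1) by auto
  ultimately show "x \<in> dbl p ` {2*m..<2*(m+k)}" by (rule image_eqI[OF sym])
qed

text \<open>A nonzero entry of J has both indices in one block. Hence each J-slot uses up a whole
  block, and injectivity of the permutation makes these blocks distinct.\<close>

lemma J_pairs_onto_blocks:
  assumes \<sigma>: "\<sigma> permutes {0..<2*(m+k)}"
    and nz: "(\<Prod>i\<in>{m..<m+k}. Jfun (\<sigma> (2*i)) (\<sigma> (2*i+1))) \<noteq> 0"
  obtains S where "S \<subseteq> {0..<m+k}" "card S = k" "\<sigma> ` {2*m..<2*(m+k)} = {x. x div 2 \<in> S}"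
proof -
  define c where "c i = \<sigma> (2*i) div 2" for i
  have inj: "\<sigma> x = \<sigma> y \<longleftrightarrow> x = y" for x y using permutes_inj[OF \<sigma>] by (auto simp: inj_def)
  have pair: "\<sigma> (2*i+1) div 2 = c i" if "i \<in> {m..<m+k}" for i
    using nz that Jfun_nonzero[of "\<sigma> (2*i)" "\<sigma> (2*i+1)"] by (auto simp: c_def)
  \<comment> \<open>Pigeonhole: a block has only two indices.\<close>
  have three: "x = y \<or> y = z \<or> x = z" if "x div 2 = z div 2" "y div 2 = z div 2" for x y z :: nat
    using that by (cases "even x"; cases "even y"; cases "even z") (auto elim!: evenE oddE)
  have "inj_on c {m..<m+k}"
  proof (rule inj_onI, rule ccontr)
    fix i j assume ij: "i \<in> {m..<m+k}" "j \<in> {m..<m+k}" "c i = c j" "i \<noteq> j"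
    have "\<sigma> (2*i) = \<sigma> (2*i+1) \<or> \<sigma> (2*i+1) = \<sigma> (2*j) \<or> \<sigma> (2*i) = \<sigma> (2*j)"
      using pair[OF ij(1)] ij(3) by (intro three) (auto simp: c_def)
    then show False using ij(4) unfolding inj by presburger
  qed
  then have card: "card (c ` {m..<m+k}) = k" by (simp add: card_image)
  have sub: "c ` {m..<m+k} \<subseteq> {0..<m+k}"
  proof
    fix x assume "x \<in> c ` {m..<m+k}"
    then obtain i where "i \<in> {m..<m+k}" "x = \<sigma> (2*i) div 2" by (auto simp: c_def)
    moreover from this have "\<sigma> (2*i) < 2*(m+k)"
      using permutes_in_image[OF \<sigma>, of "2*i"] by auto
    ultimately show "x \<in> {0..<m+k}" by auto
  qed
  have "\<sigma> ` {2*m..<2*(m+k)} = {x. x div 2 \<in> c ` {m..<m+k}}"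
  proof (intro equalityI subsetI)
    fix y assume "y \<in> \<sigma> ` {2*m..<2*(m+k)}"
    then obtain x where x: "y = \<sigma> x" "2*m \<le> x" "x < 2*(m+k)" by auto
    then have i: "x div 2 \<in> {m..<m+k}" by auto
    have "y div 2 = c (x div 2)"
      using pair[OF i] by (cases "even x") (auto simp: x c_def elim!: oddE)
    then show "y \<in> {x. x div 2 \<in> c ` {m..<m+k}}" using i by auto
  next
    fix y assume "y \<in> {x. x div 2 \<in> c ` {m..<m+k}}"
    then obtain i where i: "i \<in> {m..<m+k}" "y div 2 = c i" by auto
    have "\<sigma> (2*i) = \<sigma> (2*i+1) \<or> \<sigma> (2*i+1) = y \<or> \<sigma> (2*i) = y"
      using pair[OF i(1)] i(2) by (intro three) (auto simp: c_def)
    then have "y = \<sigma> (2*i) \<or> y = \<sigma> (2*i+1)" unfolding inj by auto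
    then show "y \<in> \<sigma> ` {2*m..<2*(m+k)}" using i(1) by auto
  qed
  with sub card show thesis by (rule that)
qed

text \<open>Write the permutation as \<open>dbl p\<close> after one that preserves the J-positions,
  where \<open>p\<close> sorts the blocks. The factor \<open>dbl p\<close> is even and leaves the
  entries of J unchanged, and the remaining permutation splits into independent parts on the two
  ranges.\<close>

lemma mixed_pf_J_block:
  fixes A :: "nat \<Rightarrow> nat \<Rightarrow> nat \<Rightarrow> real"
  assumes S: "S \<subseteq> {0..<m+k}" "card S = k"
  defines "e \<equiv> dbl (pick (- S))"
  shows "(\<Sum>\<sigma> | \<sigma> permutes {0..<2*(m+k)} \<and> \<sigma> ` {2*m..<2*(m+k)} = {x. x div 2 \<in> S}.
      of_int (sign \<sigma>) * (\<Prod>i<m+k. (if i < m then A i else Jfun) (\<sigma> (2*i)) (\<sigma> (2*i+1))))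
    = mixed_pf m (\<lambda>i a b. A i (e a) (e b)) * J_const m k"
proof -
  obtain p where p: "p permutes {0..<m+k}" "\<And>i. i < m \<Longrightarrow> p i = pick (- S) i" "p ` {m..<m+k} = S"
    using block_sort_permutation[OF S] by blast
  let ?U = "{0..<2*(m+k)}" and ?X = "{0..<2*m}" and ?Y = "{2*m..<2*(m+k)}"
  define T where "T = {x::nat. x div 2 \<in> S}"
  define f where "f \<sigma> = of_int (sign \<sigma>) * (\<Prod>i<m+k. (if i < m then A i else Jfun) (\<sigma> (2*i)) (\<sigma> (2*i+1)))" for \<sigma>
  have dp: "dbl p permutes ?U" "sign (dbl p) = 1" using dbl_permutes_sign[OF p(1)] by auto
  have injp: "inj p" using p(1) by (rule permutes_inj)
  have U: "?U = ?X \<union> ?Y" by auto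
  have fin: "finite {\<sigma>. \<sigma> permutes ?U}" by (simp add: finite_permutations)
  have img: "(dbl p \<circ> \<tau>) ` ?Y = T \<longleftrightarrow> \<tau> ` ?Y = ?Y" for \<tau>
  proof -
    have "(dbl p \<circ> \<tau>) ` ?Y = T \<longleftrightarrow> dbl p ` (\<tau> ` ?Y) = dbl p ` ?Y"
      using image_dbl[OF p(3)] by (simp add: image_comp T_def)
    then show ?thesis using inj_image_eq_iff[OF permutes_inj[OF dp(1)]] by simp
  qed
  \<comment> \<open>On the first \<open>m\<close> slots only \<open>q\<close> acts and
    \<open>dbl p\<close> agrees with \<open>e\<close>; on the J-slots only \<open>r\<close> acts and
    \<open>dbl p\<close> drops out by \<open>Jfun_dbl\<close>.\<close>
  have val: "f (dbl p \<circ> (q \<circ> r)) = (of_int (sign q) * (\<Prod>i<m. A i (e (q (2*i))) (e (q (2*i+1)))))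
      * (of_int (sign r) * (\<Prod>i\<in>{m..<m+k}. Jfun (r (2*i)) (r (2*i+1))))"
    if q: "q permutes ?X" and r: "r permutes ?Y" for q r
  proof -
    have perm: "permutation q" "permutation r" "permutation (dbl p)"
      using q r dp(1) permutes_imp_permutation finite_atLeastLessThan by blast+
    have sg: "sign (dbl p \<circ> (q \<circ> r)) = sign q * sign r"
      using perm dp(2) by (simp add: sign_compose permutation_compose del: comp_apply)
    have rX: "r x = x" if "x < 2*m" for x using permutes_not_in[OF r, of x] that by auto
    have qY: "q x = x" if "2*m \<le> x" for x using permutes_not_in[OF q, of x] that by auto
    have rY: "2*m \<le> r x" if "2*m \<le> x" "x < 2*(m+k)" for x
      using permutes_in_image[OF r, of x] that by auto
    have qX: "q x < 2*m" if "x < 2*m" for x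
      using permutes_in_image[OF q, of x] that by auto
    have ex: "dbl p x = e x" if "x < 2*m" for x
      unfolding e_def dbl_def using that p(2)[of "x div 2"] by simp
    have split: "{..<m+k} = {..<m} \<union> {m..<m+k}" by auto
    have "(\<Prod>i<m+k. (if i < m then A i else Jfun) ((dbl p \<circ> (q \<circ> r)) (2*i)) ((dbl p \<circ> (q \<circ> r)) (2*i+1)))
      = (\<Prod>i<m. A i (e (q (2*i))) (e (q (2*i+1)))) * (\<Prod>i\<in>{m..<m+k}. Jfun (r (2*i)) (r (2*i+1)))"
      unfolding split
    proof (subst prod.union_disjoint, simp, simp, force, rule arg_cong2[where f = "(*)"])
      show "(\<Prod>i<m. (if i < m then A i else Jfun) ((dbl p \<circ> (q \<circ> r)) (2*i)) ((dbl p \<circ> (q \<circ> r)) (2*i+1)))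
        = (\<Prod>i<m. A i (e (q (2*i))) (e (q (2*i+1))))"
        by (intro prod.cong) (auto simp: rX ex qX)
      show "(\<Prod>i\<in>{m..<m+k}. (if i < m then A i else Jfun) ((dbl p \<circ> (q \<circ> r)) (2*i)) ((dbl p \<circ> (q \<circ> r)) (2*i+1)))
        = (\<Prod>i\<in>{m..<m+k}. Jfun (r (2*i)) (r (2*i+1)))"
        by (intro prod.cong) (auto simp: qY rY Jfun_dbl[OF injp])
    qed
    then show ?thesis unfolding f_def sg by simp
  qed
  \<comment> \<open>The side condition becomes a conditional summand, so that left translation by
    \<open>dbl p\<close> can be applied to the sum over the full symmetric group.\<close>
  have "(\<Sum>\<sigma> | \<sigma> permutes ?U \<and> \<sigma> ` ?Y = T. f \<sigma>)
      = (\<Sum>\<sigma> | \<sigma> permutes ?U. if \<sigma> ` ?Y = T then f \<sigma> else 0)"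
    using fin by (simp add: sum.inter_filter[symmetric])
  also have "\<dots> = (\<Sum>\<tau> | \<tau> permutes ?U. if \<tau> ` ?Y = ?Y then f (dbl p \<circ> \<tau>) else 0)"
    by (subst setum_permutations_compose_left[OF dp(1)]) (simp only: img)
  also have "\<dots> = (\<Sum>\<tau> | \<tau> permutes ?U \<and> \<tau> ` ?Y = ?Y. f (dbl p \<circ> \<tau>))"
    using fin by (simp add: sum.inter_filter[symmetric])
  also have "\<dots> = (\<Sum>q | q permutes ?X. \<Sum>r | r permutes ?Y. f (dbl p \<circ> (q \<circ> r)))"
    unfolding U by (rule sum_permutes_Un) auto
  also have "\<dots> = mixed_pf m (\<lambda>i a b. A i (e a) (e b)) * J_const m k"
    unfolding mixed_pf_def J_const_def sum_product
    by (intro sum.cong refl val) auto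
  finally show ?thesis unfolding f_def T_def .
qed

text \<open>The permutations sending the J-positions onto the blocks of \<open>S\<close> form
  disjoint classes as \<open>S\<close> varies, and by \<open>J_pairs_onto_blocks\<close> every
  nonzero term lies in one of them.\<close>

lemma mixed_pf_J_expand:
  fixes A :: "nat \<Rightarrow> nat \<Rightarrow> nat \<Rightarrow> real"
  shows "mixed_pf (m+k) (\<lambda>i. if i < m then A i else Jfun)
    = J_const m k * (\<Sum>S | S \<subseteq> {0..<m+k} \<and> card S = k.
        mixed_pf m (\<lambda>i a b. A i (dbl (pick (- S)) a) (dbl (pick (- S)) b)))"
proof -
  let ?U = "{0..<2*(m+k)}" and ?Y = "{2*m..<2*(m+k)}"
  define F where "F = {S. S \<subseteq> {0..<m+k} \<and> card S = k}"
  define T where "T S = {\<sigma>. \<sigma> permutes ?U \<and> \<sigma> ` ?Y = {x::nat. x div 2 \<in> S}}" for S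
  define f where "f \<sigma> = of_int (sign \<sigma>) * (\<Prod>i<m+k. (if i < m then A i else Jfun) (\<sigma> (2*i)) (\<sigma> (2*i+1)))" for \<sigma>
  have fin: "finite {\<sigma>. \<sigma> permutes ?U}" by (simp add: finite_permutations)
  have finF: "finite F" unfolding F_def by (rule finite_subset[of _ "Pow {0..<m+k}"]) auto
  have "f \<sigma> = 0" if "\<sigma> \<in> {\<sigma>. \<sigma> permutes ?U} - (\<Union>S\<in>F. T S)" for \<sigma>
  proof (rule ccontr)
    assume "f \<sigma> \<noteq> 0"
    then have "(\<Prod>i<m+k. (if i < m then A i else Jfun) (\<sigma> (2*i)) (\<sigma> (2*i+1))) \<noteq> 0"
      by (auto simp: f_def)
    then have "(\<Prod>i\<in>{m..<m+k}. Jfun (\<sigma> (2*i)) (\<sigma> (2*i+1))) \<noteq> 0"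
      by (auto dest!: bspec[of "{..<m+k}"])
    moreover have "\<sigma> permutes ?U" using that by blast
    ultimately obtain S where "S \<subseteq> {0..<m+k}" "card S = k" "\<sigma> ` ?Y = {x. x div 2 \<in> S}"
      using J_pairs_onto_blocks by blast
    with that show False unfolding F_def T_def by blast
  qed
  then have "(\<Sum>\<sigma> | \<sigma> permutes ?U. f \<sigma>) = sum f (\<Union>S\<in>F. T S)"
    by (intro sum.mono_neutral_right[OF fin]) (auto simp: T_def)
  also have "\<dots> = (\<Sum>S\<in>F. sum f (T S))"
  proof (rule sum.UNION_disjoint[OF finF])
    show "\<forall>S\<in>F. finite (T S)" using fin by (auto simp: T_def intro: finite_subset[OF _ fin])
    \<comment> \<open>A set of blocks is recovered from the even indices it covers.\<close>
    have blocks: "R = S" if "{x::nat. x div 2 \<in> R} = {x. x div 2 \<in> S}" for R S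
    proof (rule Set.set_eqI)
      fix i
      show "i \<in> R \<longleftrightarrow> i \<in> S" using that[THEN eqset_imp_iff, of "2*i"] by simp
    qed
    show "\<forall>R\<in>F. \<forall>S\<in>F. R \<noteq> S \<longrightarrow> T R \<inter> T S = {}"
    proof (intro ballI impI equals0I)
      fix R S \<sigma> assume "R \<noteq> S" and \<sigma>: "\<sigma> \<in> T R \<inter> T S"
      have "\<sigma> ` ?Y = {x. x div 2 \<in> R}" "\<sigma> ` ?Y = {x. x div 2 \<in> S}"
        using \<sigma> unfolding T_def by blast+
      then have "{x::nat. x div 2 \<in> R} = {x. x div 2 \<in> S}" by (rule trans[OF sym])
      then have "R = S" by (rule blocks)
      with \<open>R \<noteq> S\<close> show False by contradiction
    qed
  qed
  also have "\<dots> = (\<Sum>S\<in>F. mixed_pf m (\<lambda>i a b. A i (dbl (pick (- S)) a) (dbl (pick (- S)) b)) * J_const m k)"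
    unfolding T_def f_def by (intro sum.cong refl mixed_pf_J_block) (auto simp: F_def)
  finally show ?thesis unfolding mixed_pf_def[of "m+k"] f_def F_def
    by (simp add: sum_distrib_left mult.commute)
qed

section \<open>Nonvanishing of the J-contributions\<close>

text \<open>With J in the remaining slots too, all summands of the expansion agree, because
  relabelling blocks by the injective \<open>pick (- S)\<close> preserves J; the binomial
  coefficient counts them.\<close>

lemma mixed_pf_J_J:
  "mixed_pf (m+k) (\<lambda>_. Jfun) = J_const m k * (real ((m+k) choose k) * mixed_pf m (\<lambda>_. Jfun))"
proof -
  have "mixed_pf m (\<lambda>i a b. Jfun (dbl (pick (- S)) a) (dbl (pick (- S)) b)) = mixed_pf m (\<lambda>_. Jfun)"
    if "S \<subseteq> {0..<m+k}" for S
  proof -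
    have "infinite (- S)" using that finite_subset[of S] by auto
    then have "inj (pick (- S))" using pick_eq_iff_inf[of "- S"] unfolding inj_def by blast
    then have "Jfun (dbl (pick (- S)) a) (dbl (pick (- S)) b) = Jfun a b" for a b
      by (rule Jfun_dbl) auto
    then show ?thesis by simp
  qed
  \<comment> \<open>The idle conditional gives the form family the shape required by
    \<open>mixed_pf_J_expand\<close>.\<close>
  then have "mixed_pf (m+k) (\<lambda>i. if i < m then Jfun else Jfun)
    = J_const m k * (\<Sum>S | S \<subseteq> {0..<m+k} \<and> card S = k. mixed_pf m (\<lambda>_. Jfun))"
    by (subst mixed_pf_J_expand) simp
  then show ?thesis using n_subsets[of "{0..<m+k}" k] by simp
qed

text \<open>Splitting off one J-slot multiplies by \<open>2 * (n+1)\<close>: the identity and the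
  swap of the last block each contribute 1 to \<open>J_const n 1\<close>, the sign of the swap
  cancelling that of J.\<close>

lemma mixed_pf_J_nonzero: "mixed_pf n (\<lambda>_. Jfun) \<noteq> 0"
proof (induction n)
  case 0
  then show ?case by (simp add: mixed_pf_def)
next
  case (Suc n)
  have "{2*n..<2*(n+1)} = {2*n, 2*n+1}" by auto
  then have perms: "{q. q permutes {2*n..<2*(n+1)}} = {id, transpose (2*n) (2*n+1)}"
    by (simp only: permutes_doubleton_iff) auto
  have "id \<noteq> transpose (2*n) (2*n+1)"
    by (metis eq_id_iff n_not_Suc_n Suc_eq_plus1 transpose_apply_first)
  then have "J_const n 1 = 2"
    unfolding J_const_def perms by (simp add: sign_swap_id Jfun_def)
  then show ?case using mixed_pf_J_J[of n 1] Suc by simp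
qed

text \<open>The constant is a factor of the nonzero mixed Pfaffian of J alone, so its value need not
  be computed.\<close>

lemma J_const_nonzero: "J_const m k \<noteq> 0"
proof
  assume "J_const m k = 0"
  then have "mixed_pf (m+k) (\<lambda>_. Jfun) = 0" by (simp only: mixed_pf_J_J mult_zero_left)
  then show False using mixed_pf_J_nonzero by contradiction
qed

section \<open>From deleted blocks to mixed Pfaffians\<close>

text \<open>An element of a set is its \<open>pick\<close> at the number of smaller elements. Below
  the claimed index lie \<open>a div 2\<close> complete blocks and, for odd \<open>a\<close>, also
  the even index of its own block: \<open>a\<close> elements in all.\<close>

lemma pick_blocks:
  assumes "finite S"
  shows "pick {j. j div 2 \<notin> S} a = dbl (pick (- S)) a"
proof -
  let ?I = "{j. j div 2 \<notin> S}"
  have inf: "infinite (- S)" using assms by simp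
  define c where "c = pick (- S) (a div 2)"
  have c: "c \<notin> S" using pick_in_set_inf[OF inf] by (auto simp: c_def)
  have card: "card {x\<in>- S. x < c} = a div 2" unfolding c_def by (rule card_pick_inf[OF inf])
  have mem: "dbl (pick (- S)) a \<in> ?I" using c by (simp add: dbl_def c_def)
  let ?L = "{x\<in>- S. x < c}"
  have "{x\<in>?I. x < dbl (pick (- S)) a}
      = ((\<lambda>x. 2*x) ` ?L \<union> (\<lambda>x. 2*x+1) ` ?L) \<union> (if odd a then {2*c} else {})" (is "_ = ?R")
  proof (intro equalityI subsetI)
    fix x assume "x \<in> {x\<in>?I. x < dbl (pick (- S)) a}"
    then have x: "x div 2 \<notin> S" "x < 2*c + a mod 2" by (auto simp: dbl_def c_def)
    then have "x div 2 < c \<or> odd a \<and> x = 2*c" by presburger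
    moreover have "x = 2*(x div 2) \<or> x = 2*(x div 2)+1" by presburger
    ultimately show "x \<in> ?R" using x by (auto simp del: mult_div_mod_eq)
  next
    fix x assume "x \<in> ?R"
    then show "x \<in> {x\<in>?I. x < dbl (pick (- S)) a}"
      using c by (auto simp: dbl_def c_def[symmetric] odd_iff_mod_2_eq_one split: if_splits)
  qed
  moreover have "card ?R = a"
  proof -
    have d: "(\<lambda>x::nat. 2*x) ` ?L \<inter> (\<lambda>x. 2*x+1) ` ?L = {}" by (auto; presburger)
    have "card ((\<lambda>x::nat. 2*x) ` ?L \<union> (\<lambda>x. 2*x+1) ` ?L) = 2 * (a div 2)"
      using card by (subst card_Un_disjoint[OF _ _ d]) (auto simp: card_image inj_on_def)
    moreover have "2*c \<notin> (\<lambda>x::nat. 2*x) ` ?L \<union> (\<lambda>x. 2*x+1) ` ?L" by (auto; presburger)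
    ultimately show ?thesis by auto
  qed
  ultimately have "card {x\<in>?I. x < dbl (pick (- S)) a} = a" by simp
  with pick_card_in_set[OF mem] show ?thesis by simp
qed

lemma pfaffian_delete_blocks:
  assumes M: "M \<in> carrier_mat (2*(m+k)) (2*(m+k))" and S: "S \<subseteq> {0..<m+k}" "card S = k"
  shows "pfaffian (delete_blocks M S)
    = mixed_pf m (\<lambda>_ a b. M $$ (dbl (pick (- S)) a, dbl (pick (- S)) b)) / (2^m * fact m)"
proof -
  have fin: "finite S" using S finite_subset by blast
  let ?L = "{0..<m+k} - S"
  have cL: "card ?L = m" using S fin by (simp add: card_Diff_subset)
  have "{i. i < 2*(m+k) \<and> i div 2 \<notin> S} = (\<lambda>x. 2*x) ` ?L \<union> (\<lambda>x. 2*x+1) ` ?L"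
  proof (intro equalityI subsetI)
    fix i assume i: "i \<in> {i. i < 2*(m+k) \<and> i div 2 \<notin> S}"
    moreover have "i = 2*(i div 2) \<or> i = 2*(i div 2)+1" by presburger
    moreover have "i div 2 \<in> ?L" using i by auto
    ultimately show "i \<in> (\<lambda>x. 2*x) ` ?L \<union> (\<lambda>x. 2*x+1) ` ?L" by blast
  qed auto
  moreover have d: "(\<lambda>x::nat. 2*x) ` ?L \<inter> (\<lambda>x. 2*x+1) ` ?L = {}" by (auto; presburger)
  ultimately have card: "card {i. i < 2*(m+k) \<and> i div 2 \<notin> S} = 2*m"
    using cL by (simp only:, subst card_Un_disjoint[OF _ _ d]) (auto simp: card_image inj_on_def)
  have dim: "dim_row (delete_blocks M S) div 2 = m"
    using M card unfolding delete_blocks_def dim_submatrix by simp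
  have ent: "delete_blocks M S $$ (a,b) = M $$ (dbl (pick (- S)) a, dbl (pick (- S)) b)"
    if "a < 2*m" "b < 2*m" for a b
    using that M card unfolding delete_blocks_def
    by (subst submatrix_index) (auto simp: pick_blocks[OF fin])
  have "mixed_pf m (\<lambda>_ a b. M $$ (dbl (pick (- S)) a, dbl (pick (- S)) b))
      = mixed_pf m (\<lambda>_ a b. delete_blocks M S $$ (a,b))"
    by (rule mixed_pf_cong) (simp add: ent)
  then show ?thesis unfolding pfaffian_def Let_def dim mixed_pf_def by simp
qed

text \<open>The factor in front is nonzero and independent of \<open>M\<close>, so invariance of the
  mixed Pfaffian carries over to \<open>s_k\<close>.\<close>

lemma s_k_eq_mixed_pf:
  assumes M: "M \<in> carrier_mat (2*(m+k)) (2*(m+k))"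
  shows "J_const m k * (2^m * fact m) * s_k (m+k) k M
    = mixed_pf (m+k) (\<lambda>i. if i < m then (\<lambda>a b. M $$ (a,b)) else Jfun)"
proof -
  have "(2^m * fact m) * s_k (m+k) k M = (\<Sum>S | S \<subseteq> {0..<m+k} \<and> card S = k.
      mixed_pf m (\<lambda>_ a b. M $$ (dbl (pick (- S)) a, dbl (pick (- S)) b)))"
    unfolding s_k_def sum_distrib_left
    by (intro sum.cong refl) (simp add: pfaffian_delete_blocks[OF M])
  then show ?thesis
    by (subst mixed_pf_J_expand) (simp add: mult.assoc)
qed

section \<open>Symplectic invariance\<close>

lemma congruence_index:
  fixes P M :: "'a :: comm_semiring_0 mat"
  assumes "P \<in> carrier_mat N N" "M \<in> carrier_mat N N" "a < N" "b < N"
  shows "(transpose_mat P * M * P) $$ (a,b) = (\<Sum>x<N. \<Sum>y<N. P $$ (x,a) * M $$ (x,y) * P $$ (y,b))"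
proof -
  have "(transpose_mat P * M * P) $$ (a,b) = (\<Sum>x<N. P $$ (x,a) * (\<Sum>y<N. M $$ (x,y) * P $$ (y,b)))"
    using assms by (auto simp: scalar_prod_def lessThan_atLeast0 intro!: sum.cong)
  then show ?thesis by (simp add: sum_distrib_left mult.assoc)
qed

theorem theorem2p8:
  fixes n k :: nat and A P :: "real mat"
  assumes "A \<in> skew_inv n" and "k \<le> n - 1" and "k < n" and "P \<in> Sp n"
  shows "s_k n k (transpose_mat P * A * P) = s_k n k A"
proof -
  have A: "A \<in> carrier_mat (2*n) (2*n)" using assms(1) by (simp add: skew_inv_def)
  have P: "P \<in> carrier_mat (2*n) (2*n)" and PJ: "transpose_mat P * Jmat n * P = Jmat n"
    using assms(4) by (auto simp: Sp_def)
  define m where "m = n - k"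
  have n: "n = m + k" using assms(3) by (simp add: m_def)
  have J: "Jmat n \<in> carrier_mat (2*n) (2*n)" by (simp add: Jmat_def)
  have J_index: "Jmat n $$ (a,b) = Jfun a b" if "a < 2*n" "b < 2*n" for a b
    using that by (simp add: Jmat_def Jfun_def)
  have J_cong: "(\<Sum>x<2*n. \<Sum>y<2*n. P $$ (x,a) * Jfun x y * P $$ (y,b)) = Jfun a b"
    if "a < 2*n" "b < 2*n" for a b
    using congruence_index[OF P J that] that unfolding PJ by (simp add: J_index)
  \<comment> \<open>The congruence fixes J in every slot, so the mixed Pfaffian of J equals
    \<open>det P\<close> times itself.\<close>
  have "mixed_pf n (\<lambda>_. Jfun) = det P * mixed_pf n (\<lambda>_. Jfun)"
    by (subst mixed_pf_congruence[OF P, symmetric]) (rule mixed_pf_cong, simp add: J_cong)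
  then have det: "det P = 1" using mixed_pf_J_nonzero[of n] by simp
  let ?B = "\<lambda>M i. if i < m then (\<lambda>a b. M $$ (a,b)) else Jfun"
  let ?A' = "transpose_mat P * A * P"
  have A': "?A' \<in> carrier_mat (2*n) (2*n)" using A P by auto
  \<comment> \<open>Acting on all slots at once, the congruence turns A into \<open>?A'\<close> in
    the first \<open>m\<close> slots and leaves J in the last \<open>k\<close>.\<close>
  have "mixed_pf n (?B ?A') = mixed_pf n (\<lambda>i a b. \<Sum>x<2*n. \<Sum>y<2*n. P $$ (x,a) * ?B A i x y * P $$ (y,b))"
    by (rule mixed_pf_cong) (simp add: J_cong congruence_index[OF P A])
  also have "\<dots> = mixed_pf n (?B A)" by (simp add: mixed_pf_congruence[OF P] det)
  finally have "J_const m k * (2^m * fact m) * s_k n k ?A' = J_const m k * (2^m * fact m) * s_k n k A"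
    using s_k_eq_mixed_pf[of A m k] s_k_eq_mixed_pf[of ?A' m k] A A' unfolding n by simp
  then show ?thesis using J_const_nonzero[of m k] by simp
qed

end
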